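(* Suppose $-1<\alpha<0$, $m\ge 0$ and $q>0$. Then the constrained variational problem $(P_0)$ has a unique global minimizer $\mathbf u=(u_1,u_0,u_{-1})$, where $$u_1=\frac{q+b}{2q}\left[n+\frac1\alpha\left(\frac q2-\frac{b^2}{2q}\right)\right]^{1/2},$$ $$u_0=\left[\frac{q^2-b^2}{2q^2}\,n-\frac{q^2+b^2}{2q^2}\,\frac1\alpha\left(\frac q2-\frac{b^2}{2q}\right)\right]^{1/2},$$ $$u_{-1}=\frac{q-b}{2q}\left[n+\frac1\alpha\left(\frac q2-\frac{b^2}{2q}\right)\right]^{1/2}.$$ The value $b$ is the unique root in $\left(\sqrt{q^2+2\alpha qn},\,q\right)$ of the cubic equation $$b^3-(q^2+2\alpha qn)\,b+2\alpha q^2m=0.$$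
   Context: $\Omega\subset\mathbb R^3$ is a bounded domain with smooth boundary, $|\Omega|$ denotes its Lebesgue measure, and $\mathbb R_+=[0,\infty)$. Real numbers $\alpha$, $q$, $N$ (total mass, $N>0$) and $M$ (total magnetization, $M\le N$) are given; put $n=N/|\Omega|$ and $m=M/|\Omega|$. A state is written $\mathbf u=(u_1,u_0,u_{-1})$ with values in $\mathbb R_+^3$. The Thomas-Fermi Hamiltonian is $$H_{TF}(\mathbf u)=\tfrac12(u_1^2+u_0^2+u_{-1}^2)^2+\tfrac{\alpha}{2}\left[2u_0^2(u_1-\mathrm{sgn}(\alpha)u_{-1})^2+(u_1^2-u_{-1}^2)^2\right]+q(u_1^2+u_{-1}^2).$$ Problem $(P_0)$: minimize $\int_\Omega H_{TF}(\mathbf u(x))\,dx$ over all $\mathbf u\in (L^2(\Omega,\mathbb R_+))^3$ subject to $\int_\Omega (u_1^2+u_0^2+u_{-1}^2)\,dx=N$ and $\int_\Omega (u_1^2-u_{-1}^2)\,dx=M$. The minimizer in the claim is a constant function on $\Omega$.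
   Formalization: For m=0 or m=n the cubic has no root in the open interval, so b is the unique root in the closed interval (in the open one if 0<m<n); where q²+2αqn<0 the lower endpoint is read as 0. *)

theory Defs
  imports "HOL-Analysis.Analysis"
begin

text \<open>\<open>C\<^sup>k\<close> and \<open>C\<^sup>\<infinity>\<close> real-valued functions on an open set \<open>S\<close>, by iterated partial derivatives.\<close>

primrec Ck_on :: "nat \<Rightarrow> ('a::euclidean_space \<Rightarrow> real) \<Rightarrow> 'a set \<Rightarrow> bool" where
  "Ck_on 0 f S \<longleftrightarrow> continuous_on S f"
| "Ck_on (Suc k) f S \<longleftrightarrow>
     f differentiable_on S \<and> (\<forall>i\<in>Basis. Ck_on k (\<lambda>x. frechet_derivative f (at x) i) S)"

definition smooth_fun_on :: "('a::euclidean_space \<Rightarrow> real) \<Rightarrow> 'a set \<Rightarrow> bool" where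
  "smooth_fun_on f S \<longleftrightarrow> (\<forall>k. Ck_on k f S)"

text \<open>Near each boundary point, \<open>\<Omega>\<close> is the sublevel set of a smooth function with
  nonvanishing derivative; in particular \<open>\<Omega>\<close> lies locally on one side of its boundary.\<close>

definition smooth_boundary :: "'a::euclidean_space set \<Rightarrow> bool" where
  "smooth_boundary \<Omega> \<longleftrightarrow>
     (\<forall>p\<in>frontier \<Omega>. \<exists>U \<phi>. open U \<and> p \<in> U \<and> smooth_fun_on \<phi> U \<and>
        (\<forall>x\<in>U. frechet_derivative \<phi> (at x) \<noteq> (\<lambda>_. 0)) \<and>
        \<Omega> \<inter> U = {x\<in>U. \<phi> x < 0})"

definition smooth_bounded_domain :: "'a::euclidean_space set \<Rightarrow> bool" where
  "smooth_bounded_domain \<Omega> \<longleftrightarrow>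
     open \<Omega> \<and> connected \<Omega> \<and> \<Omega> \<noteq> {} \<and> bounded \<Omega> \<and> smooth_boundary \<Omega>"

text \<open>The arguments \<open>u1\<close>, \<open>u0\<close>, \<open>um\<close> stand for the components $u_1$, $u_0$, $u_{-1}$.\<close>

definition H_TF :: "real \<Rightarrow> real \<Rightarrow> real \<Rightarrow> real \<Rightarrow> real \<Rightarrow> real" where
  "H_TF \<alpha> q u1 u0 um =
     1/2 * (u1\<^sup>2 + u0\<^sup>2 + um\<^sup>2)\<^sup>2
     + \<alpha>/2 * (2 * u0\<^sup>2 * (u1 - sgn \<alpha> * um)\<^sup>2 + (u1\<^sup>2 - um\<^sup>2)\<^sup>2)
     + q * (u1\<^sup>2 + um\<^sup>2)"

text \<open>Representatives of elements of \<open>L\<^sup>2(\<Omega>, [0,\<infinity>))\<close>: only values almost everywhere on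
  \<open>\<Omega>\<close> matter.\<close>

definition L2_nonneg :: "'a::euclidean_space set \<Rightarrow> ('a \<Rightarrow> real) set" where
  "L2_nonneg \<Omega> = {f \<in> borel_measurable (lebesgue_on \<Omega>).
     integrable (lebesgue_on \<Omega>) (\<lambda>x. (f x)\<^sup>2) \<and> (AE x in lebesgue_on \<Omega>. 0 \<le> f x)}"

type_synonym 'a state = "('a \<Rightarrow> real) \<times> ('a \<Rightarrow> real) \<times> ('a \<Rightarrow> real)"

definition admissible :: "'a::euclidean_space set \<Rightarrow> real \<Rightarrow> real \<Rightarrow> 'a state set" where
  "admissible \<Omega> N M =
     {(u1, u0, um). u1 \<in> L2_nonneg \<Omega> \<and> u0 \<in> L2_nonneg \<Omega> \<and> um \<in> L2_nonneg \<Omega> \<and>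
        (LINT x|lebesgue_on \<Omega>. (u1 x)\<^sup>2 + (u0 x)\<^sup>2 + (um x)\<^sup>2) = N \<and>
        (LINT x|lebesgue_on \<Omega>. (u1 x)\<^sup>2 - (um x)\<^sup>2) = M}"

text \<open>The Hamiltonian is quartic, so its integral over an \<open>L\<^sup>2\<close> state may be \<open>\<infinity>\<close>. The Bochner
  integral would then be 0, so the energy is instead the extended integral, i.e. the integral of
  the positive part minus that of the negative part.\<close>

definition energy :: "'a::euclidean_space set \<Rightarrow> real \<Rightarrow> real \<Rightarrow> 'a state \<Rightarrow> ereal" where
  "energy \<Omega> \<alpha> q = (\<lambda>(u1, u0, um).
     enn2ereal (\<integral>\<^sup>+x. ennreal (H_TF \<alpha> q (u1 x) (u0 x) (um x)) \<partial>lebesgue_on \<Omega>)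
     - enn2ereal (\<integral>\<^sup>+x. ennreal (- H_TF \<alpha> q (u1 x) (u0 x) (um x)) \<partial>lebesgue_on \<Omega>))"

definition is_global_minimizer ::
    "'a::euclidean_space set \<Rightarrow> real \<Rightarrow> real \<Rightarrow> real \<Rightarrow> real \<Rightarrow> 'a state \<Rightarrow> bool" where
  "is_global_minimizer \<Omega> \<alpha> q N M u \<longleftrightarrow>
     u \<in> admissible \<Omega> N M \<and> (\<forall>v\<in>admissible \<Omega> N M. energy \<Omega> \<alpha> q u \<le> energy \<Omega> \<alpha> q v)"

text \<open>Lower endpoint $\sqrt{q^2+2\alpha q n}$ of the interval for \<open>b\<close>. Since \<open>\<alpha> < 0\<close> the radicand may
  be negative; the endpoint is then 0 (HOL's \<open>sqrt\<close> of a negative number would be negative).\<close>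

definition b_lower :: "real \<Rightarrow> real \<Rightarrow> real \<Rightarrow> real" where
  "b_lower \<alpha> q n = sqrt (max 0 (q\<^sup>2 + 2 * \<alpha> * q * n))"

text \<open>For \<open>m = 0\<close> or \<open>m = n\<close> the root describing the minimizer is an endpoint of the interval
  (\<open>b = b_lower \<alpha> q n\<close> and \<open>b = q\<close>, respectively), so the interval is taken closed here; for
  \<open>0 < m < n\<close> the root lies in the open interval.\<close>

definition b_root :: "real \<Rightarrow> real \<Rightarrow> real \<Rightarrow> real \<Rightarrow> real \<Rightarrow> bool" where
  "b_root \<alpha> q n m b \<longleftrightarrow>
     b \<in> {b_lower \<alpha> q n..q} \<and> b^3 - (q\<^sup>2 + 2 * \<alpha> * q * n) * b + 2 * \<alpha> * q\<^sup>2 * m = 0"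

end

theory Submission
  imports Defs
begin

text \<open>Put \<open>\<rho> = u1\<^sup>2 + u0\<^sup>2 + um\<^sup>2\<close>, \<open>s = u1 + um\<close> and \<open>d = u1 - um\<close>, so that
  \<open>s * d = u1\<^sup>2 - um\<^sup>2\<close>. For \<open>\<alpha> < 0\<close> the Hamiltonian equals
  \<open>(1 + \<alpha>)/2 * \<rho>\<^sup>2 - \<alpha>/2 * (\<rho> - s\<^sup>2)\<^sup>2 + q/2 * (s\<^sup>2 + d\<^sup>2)\<close>,
  which is convex in \<open>(\<rho>, s\<^sup>2, s * d)\<close> if moreover \<open>-1 < \<alpha>\<close>. Its tangent functional at the
  claimed minimizer is affine in the two constrained densities \<open>\<rho>\<close> and \<open>s * d\<close> (with
  multiplier \<open>b\<close> for the latter), and the difference is a sum of three squares vanishing only at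
  the claimed minimizer. Integrating over \<open>\<Omega>\<close> turns the affine part into a constant.\<close>

section \<open>The root of the cubic\<close>

text \<open>On the closed interval the cubic is strictly increasing. It equals
  \<open>2 * \<alpha> * q\<^sup>2 * m\<close> \<le> 0 at the left end and
  \<open>-2 * \<alpha> * q\<^sup>2 * (n - m)\<close> \<ge> 0 at the right end, so the intermediate
  value theorem yields a root and monotonicity makes it the only one. For 0 < m < n both signs are
  strict, which excludes the endpoints.\<close>

lemma b_root_unique_existence:
  fixes \<alpha> q n m :: real
  assumes "\<alpha> < 0" "q > 0" "0 \<le> m" "m \<le> n"
  obtains b where "b_root \<alpha> q n m b" "\<And>b'. b_root \<alpha> q n m b' \<Longrightarrow> b' = b"
    "0 < m \<Longrightarrow> m < n \<Longrightarrow> b \<in> {b_lower \<alpha> q n<..<q}"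
proof -
  define r where "r = q\<^sup>2 + 2 * \<alpha> * q * n"
  define l where "l = b_lower \<alpha> q n"
  define f where "f b = b^3 - r * b + 2 * \<alpha> * q\<^sup>2 * m" for b
  have root_iff: "b_root \<alpha> q n m b \<longleftrightarrow> l \<le> b \<and> b \<le> q \<and> f b = 0" for b
    by (auto simp: b_root_def f_def r_def l_def)
  have l0: "0 \<le> l" and l2: "l\<^sup>2 = max 0 r"
    by (auto simp: l_def b_lower_def r_def)
  have "2 * \<alpha> * q * n \<le> 0"
    using assms by (simp add: mult_nonpos_nonneg)
  hence "r \<le> q\<^sup>2" unfolding r_def by linarith
  hence "l\<^sup>2 \<le> q\<^sup>2" unfolding l2 by simp
  hence lq: "l \<le> q" using assms(2) by (rule power2_le_imp_le[OF _ less_imp_le])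
  have c: "2 * \<alpha> * q\<^sup>2 * m \<le> 0" using assms by (simp add: mult_nonpos_nonneg)
  \<comment> \<open>Either \<open>l\<^sup>2 = r\<close>, or \<open>r\<close> is negative and
    \<open>l = 0\<close>.\<close>
  have "l * (l\<^sup>2 - r) = 0"
    using l0 l2 by (cases "r \<ge> 0") (auto simp: max_def split: if_splits)
  hence fl: "f l = 2 * \<alpha> * q\<^sup>2 * m"
    by (simp add: f_def power3_eq_cube power2_eq_square algebra_simps)
  have fq: "f q = -2 * \<alpha> * q\<^sup>2 * (n - m)"
    by (simp add: f_def r_def power3_eq_cube power2_eq_square algebra_simps)
  have fq0: "0 \<le> f q" unfolding fq using assms by (simp add: mult_nonneg_nonneg mult_nonpos_nonneg)
  have f_strict: "f x < f y" if "l \<le> x" "x < y" for x y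
  proof -
    have "r \<le> x\<^sup>2" using l2 power_mono[OF that(1) l0, of 2] by simp
    moreover have "0 \<le> x" using that l0 by simp
    \<comment> \<open>This is the difference quotient of \<open>f\<close>; after
      \<open>r \<le> x\<^sup>2\<close> is used, at least \<open>y\<^sup>2 > 0\<close>
      remains.\<close>
    ultimately have "0 < x\<^sup>2 + x * y + y\<^sup>2 - r"
      using that mult_nonneg_nonneg[of x y] zero_less_power[of y 2] by linarith
    hence "0 < (y - x) * (x\<^sup>2 + x * y + y\<^sup>2 - r)" using that by simp
    also have "\<dots> = f y - f x"
      by (simp add: f_def power3_eq_cube power2_eq_square algebra_simps)
    finally show ?thesis by simp
  qed
  have "continuous_on {l..q} f" unfolding f_def by (intro continuous_intros)
  then obtain b where b: "l \<le> b" "b \<le> q" "f b = 0"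
    using IVT'[of f l 0 q] fl c fq0 lq by auto
  show ?thesis
  proof
    show "b_root \<alpha> q n m b" using b root_iff by simp
    show "b' = b" if "b_root \<alpha> q n m b'" for b'
      using that b f_strict[of b b'] f_strict[of b' b] unfolding root_iff
      by (metis less_irrefl linorder_neqE_linordered_idom)
    show "b \<in> {b_lower \<alpha> q n<..<q}" if "0 < m" "m < n"
    proof -
      have "f l < 0" unfolding fl using that assms by (simp add: mult_neg_pos)
      moreover have "0 < f q" unfolding fq using that assms by (simp add: mult_neg_pos)
      ultimately show ?thesis using b unfolding l_def by (metis greaterThanLessThan_iff
          less_irrefl order_le_less)
    qed
  qed
qed

section \<open>Tangent decomposition of the Hamiltonian\<close>

text \<open>For \<open>A\<close> as in \<open>H_TF_eq_affine_plus_gap\<close>, this is the excess of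
  the Hamiltonian over its tangent functional. The squares measure the deviation from
  \<open>\<rho> = n\<close>, \<open>\<rho> - s\<^sup>2 = -A\<close> and
  \<open>d = b / q * s\<close>.\<close>

definition TF_gap :: "real \<Rightarrow> real \<Rightarrow> real \<Rightarrow> real \<Rightarrow> real \<Rightarrow> real \<Rightarrow> real \<Rightarrow> real \<Rightarrow> real" where
  "TF_gap \<alpha> q n A b u1 u0 um =
     (1 + \<alpha>) / 2 * (u1\<^sup>2 + u0\<^sup>2 + um\<^sup>2 - n)\<^sup>2
     - \<alpha> / 2 * (u1\<^sup>2 + u0\<^sup>2 + um\<^sup>2 - (u1 + um)\<^sup>2 + A)\<^sup>2
     + q / 2 * ((u1 - um) - b / q * (u1 + um))\<^sup>2"

text \<open>Completing the three squares leaves terms affine in \<open>\<rho>\<close> and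
  \<open>s * d\<close>, plus a multiple of \<open>s\<^sup>2\<close>, which no constraint controls.
  The value of \<open>A\<close> is the one that makes this multiple vanish.\<close>

lemma H_TF_eq_affine_plus_gap:
  assumes "\<alpha> < 0" "q > 0" "A = 1 / \<alpha> * (q / 2 - b\<^sup>2 / (2 * q))"
  shows "H_TF \<alpha> q u1 u0 um =
    ((1 + \<alpha>) * n + \<alpha> * A) * (u1\<^sup>2 + u0\<^sup>2 + um\<^sup>2) + b * (u1\<^sup>2 - um\<^sup>2)
    + (\<alpha> * A\<^sup>2 - (1 + \<alpha>) * n\<^sup>2) / 2 + TF_gap \<alpha> q n A b u1 u0 um"
proof -
  define \<beta> where "\<beta> = b / q"
  have b: "b = q * \<beta>" using assms by (simp add: \<beta>_def)
  have A: "\<alpha> * A = q / 2 - q * \<beta>\<^sup>2 / 2"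
    using assms by (simp add: b field_simps power2_eq_square)
  have "H_TF \<alpha> q u1 u0 um =
    ((1 + \<alpha>) * n + \<alpha> * A) * (u1\<^sup>2 + u0\<^sup>2 + um\<^sup>2) + q * \<beta> * (u1\<^sup>2 - um\<^sup>2)
    + (\<alpha> * A\<^sup>2 - (1 + \<alpha>) * n\<^sup>2) / 2 + TF_gap \<alpha> q n A b u1 u0 um
    + (q / 2 - q * \<beta>\<^sup>2 / 2 - \<alpha> * A) * (u1 + um)\<^sup>2"
    using assms(1) unfolding H_TF_def TF_gap_def \<beta>_def[symmetric] sgn_neg[OF assms(1)]
    by (simp add: field_simps power2_eq_square)
  thus ?thesis using A b by simp
qed

text \<open>The coefficients \<open>1 + \<alpha>\<close>, \<open>-\<alpha>\<close> and
  \<open>q\<close> are all positive. As a consequence the negative part contributes nothing to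
  \<open>energy\<close>.\<close>

lemma H_TF_nonneg:
  assumes "-1 < \<alpha>" "\<alpha> < 0" "q > 0"
  shows "0 \<le> H_TF \<alpha> q u1 u0 um"
proof -
  have "H_TF \<alpha> q u1 u0 um = (1 + \<alpha>) / 2 * (u1\<^sup>2 + u0\<^sup>2 + um\<^sup>2)\<^sup>2
      - \<alpha> / 2 * (u1\<^sup>2 + u0\<^sup>2 + um\<^sup>2 - (u1 + um)\<^sup>2)\<^sup>2 + q * (u1\<^sup>2 + um\<^sup>2)"
    using assms(2) by (simp add: H_TF_def field_simps power2_eq_square)
  moreover have "0 \<le> (1 + \<alpha>) / 2 * (u1\<^sup>2 + u0\<^sup>2 + um\<^sup>2)\<^sup>2"
    "\<alpha> / 2 * (u1\<^sup>2 + u0\<^sup>2 + um\<^sup>2 - (u1 + um)\<^sup>2)\<^sup>2 \<le> 0" "0 \<le> q * (u1\<^sup>2 + um\<^sup>2)"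
    using assms by (simp_all add: mult_nonpos_nonneg)
  ultimately show ?thesis by linarith
qed

lemma TF_gap_nonneg:
  assumes "-1 < \<alpha>" "\<alpha> < 0" "q > 0"
  shows "0 \<le> TF_gap \<alpha> q n A b u1 u0 um"
proof -
  have "0 \<le> (1 + \<alpha>) / 2 * (u1\<^sup>2 + u0\<^sup>2 + um\<^sup>2 - n)\<^sup>2"
    "\<alpha> / 2 * (u1\<^sup>2 + u0\<^sup>2 + um\<^sup>2 - (u1 + um)\<^sup>2 + A)\<^sup>2 \<le> 0"
    "0 \<le> q / 2 * ((u1 - um) - b / q * (u1 + um))\<^sup>2"
    using assms by (simp_all add: mult_nonpos_nonneg)
  thus ?thesis unfolding TF_gap_def by linarith
qed

text \<open>With positive weights, all three squares must vanish; subtracting the second condition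
  from the first turns it into a value for \<open>s\<^sup>2\<close>.\<close>

lemma TF_gap_eq_0_iff:
  assumes "-1 < \<alpha>" "\<alpha> < 0" "q > 0"
  shows "TF_gap \<alpha> q n A b u1 u0 um = 0 \<longleftrightarrow>
    u1\<^sup>2 + u0\<^sup>2 + um\<^sup>2 = n \<and> (u1 + um)\<^sup>2 = n + A \<and> u1 - um = b / q * (u1 + um)"
proof
  define x y z where "x = u1\<^sup>2 + u0\<^sup>2 + um\<^sup>2 - n"
    and "y = u1\<^sup>2 + u0\<^sup>2 + um\<^sup>2 - (u1 + um)\<^sup>2 + A"
    and "z = (u1 - um) - b / q * (u1 + um)"
  assume "TF_gap \<alpha> q n A b u1 u0 um = 0"
  hence "(1 + \<alpha>) / 2 * x\<^sup>2 - \<alpha> / 2 * y\<^sup>2 + q / 2 * z\<^sup>2 = 0"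
    by (simp add: TF_gap_def x_def y_def z_def)
  moreover have "0 \<le> (1 + \<alpha>) / 2 * x\<^sup>2" "\<alpha> / 2 * y\<^sup>2 \<le> 0" "0 \<le> q / 2 * z\<^sup>2"
    using assms by (simp_all add: mult_nonpos_nonneg)
  ultimately have "(1 + \<alpha>) / 2 * x\<^sup>2 = 0 \<and> \<alpha> / 2 * y\<^sup>2 = 0 \<and> q / 2 * z\<^sup>2 = 0" by linarith
  hence "x = 0" "y = 0" "z = 0" using assms by auto
  thus "u1\<^sup>2 + u0\<^sup>2 + um\<^sup>2 = n \<and> (u1 + um)\<^sup>2 = n + A \<and> u1 - um = b / q * (u1 + um)"
    by (simp add: x_def y_def z_def)
qed (simp add: TF_gap_def)

section \<open>Energy of admissible states\<close>

lemma L2_nonneg_measurable: "f \<in> L2_nonneg \<Omega> \<Longrightarrow> f \<in> borel_measurable (lebesgue_on \<Omega>)"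
  by (simp add: L2_nonneg_def)

lemma L2_nonneg_integrable: "f \<in> L2_nonneg \<Omega> \<Longrightarrow> integrable (lebesgue_on \<Omega>) (\<lambda>x. (f x)\<^sup>2)"
  by (simp add: L2_nonneg_def)

lemma energy_eq_nn_integral:
  assumes "-1 < \<alpha>" "\<alpha> < 0" "q > 0"
  shows "energy \<Omega> \<alpha> q (v1, v0, vm) =
    enn2ereal (\<integral>\<^sup>+x. ennreal (H_TF \<alpha> q (v1 x) (v0 x) (vm x)) \<partial>lebesgue_on \<Omega>)"
proof -
  have "ennreal (- H_TF \<alpha> q (v1 x) (v0 x) (vm x)) = 0" for x
    using H_TF_nonneg[OF assms] by (simp add: ennreal_neg)
  thus ?thesis by (simp add: energy_def zero_ennreal.rep_eq)
qed

text \<open>The constraints fix the integrals of \<open>\<rho>\<close> and \<open>s * d\<close>, so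
  the affine part contributes the same constant for every admissible state, and finite energies
  differ only in the integral of the gap.\<close>

lemma energy_eq_affine_plus_gap:
  assumes \<Omega>: "\<Omega> \<in> lmeasurable" and par: "-1 < \<alpha>" "\<alpha> < 0" "q > 0"
    and A: "A = 1 / \<alpha> * (q / 2 - b\<^sup>2 / (2 * q))"
    and v: "(v1, v0, vm) \<in> admissible \<Omega> N M"
    and fin: "energy \<Omega> \<alpha> q (v1, v0, vm) \<noteq> \<infinity>"
  shows "integrable (lebesgue_on \<Omega>) (\<lambda>x. TF_gap \<alpha> q n A b (v1 x) (v0 x) (vm x))"
    and "energy \<Omega> \<alpha> q (v1, v0, vm) =
      ereal (((1 + \<alpha>) * n + \<alpha> * A) * N + b * M
        + measure lebesgue \<Omega> * ((\<alpha> * A\<^sup>2 - (1 + \<alpha>) * n\<^sup>2) / 2)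
        + (LINT x|lebesgue_on \<Omega>. TF_gap \<alpha> q n A b (v1 x) (v0 x) (vm x)))"
proof -
  let ?\<mu> = "lebesgue_on \<Omega>"
  define c where "c = (1 + \<alpha>) * n + \<alpha> * A"
  define k where "k = (\<alpha> * A\<^sup>2 - (1 + \<alpha>) * n\<^sup>2) / 2"
  define H where "H = (\<lambda>x. H_TF \<alpha> q (v1 x) (v0 x) (vm x))"
  define G where "G = (\<lambda>x. TF_gap \<alpha> q n A b (v1 x) (v0 x) (vm x))"
  define R where "R = (\<lambda>x. (v1 x)\<^sup>2 + (v0 x)\<^sup>2 + (vm x)\<^sup>2)"
  define D where "D = (\<lambda>x. (v1 x)\<^sup>2 - (vm x)\<^sup>2)"
  interpret finite_measure ?\<mu>
    using \<Omega> by (rule finite_measure_lebesgue_on)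
  have v': "v1 \<in> L2_nonneg \<Omega>" "v0 \<in> L2_nonneg \<Omega>" "vm \<in> L2_nonneg \<Omega>"
    and N: "integral\<^sup>L ?\<mu> R = N" and M: "integral\<^sup>L ?\<mu> D = M"
    using v by (auto simp: admissible_def R_def D_def)
  note [measurable] = v'[THEN L2_nonneg_measurable]
  note int = v'[THEN L2_nonneg_integrable]
  have R: "integrable ?\<mu> R" and D: "integrable ?\<mu> D"
    unfolding R_def D_def using int by auto
  have Hm: "H \<in> borel_measurable ?\<mu>" unfolding H_def H_TF_def by measurable
  have H0: "0 \<le> H x" for x unfolding H_def by (rule H_TF_nonneg[OF par])
  have E: "energy \<Omega> \<alpha> q (v1, v0, vm) = enn2ereal (\<integral>\<^sup>+x. ennreal (H x) \<partial>?\<mu>)"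
    unfolding energy_eq_nn_integral[OF par] H_def ..
  \<comment> \<open>Square integrability of the components does not control the quartic
    \<open>H\<close>; its integrability comes from finite energy and
    \<open>H \<ge> 0\<close>.\<close>
  have "(\<integral>\<^sup>+x. ennreal (H x) \<partial>?\<mu>) \<noteq> \<infinity>"
    using fin E by (metis enn2ereal_eq_top_iff infinity_ennreal_def top_ereal_def)
  hence Hi: "integrable ?\<mu> H"
    using Hm H0 by (intro integrableI_nonneg) (auto simp: top.not_eq_extremum)
  have HG: "G = (\<lambda>x. H x - (c * R x + b * D x + k))"
    unfolding H_def G_def R_def D_def c_def k_def
    by (subst H_TF_eq_affine_plus_gap[OF par(2,3) A, where n = n]) simp
  have aff: "integrable ?\<mu> (\<lambda>x. c * R x + b * D x + k)" using R D by auto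
  show "integrable ?\<mu> (\<lambda>x. TF_gap \<alpha> q n A b (v1 x) (v0 x) (vm x))"
    using Hi aff unfolding G_def[symmetric] HG by auto
  have "integral\<^sup>L ?\<mu> G = integral\<^sup>L ?\<mu> H - (c * N + b * M + measure ?\<mu> (space ?\<mu>) * k)"
    unfolding HG using Hi aff R D N M by (simp add: algebra_simps)
  moreover have "measure ?\<mu> (space ?\<mu>) = measure lebesgue \<Omega>"
    using \<Omega> by (simp add: measure_restrict_space fmeasurableD)
  moreover have "energy \<Omega> \<alpha> q (v1, v0, vm) = ereal (integral\<^sup>L ?\<mu> H)"
    unfolding E using Hi H0 by (subst nn_integral_eq_integral)
      (auto simp: enn2ereal_ennreal integral_nonneg_AE)
  ultimately show "energy \<Omega> \<alpha> q (v1, v0, vm) =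
      ereal (((1 + \<alpha>) * n + \<alpha> * A) * N + b * M
        + measure lebesgue \<Omega> * ((\<alpha> * A\<^sup>2 - (1 + \<alpha>) * n\<^sup>2) / 2)
        + (LINT x|lebesgue_on \<Omega>. TF_gap \<alpha> q n A b (v1 x) (v0 x) (vm x)))"
    unfolding c_def[symmetric] k_def[symmetric] G_def[symmetric] by simp
qed

lemma energy_const_finite:
  assumes "\<Omega> \<in> lmeasurable" "-1 < \<alpha>" "\<alpha> < 0" "q > 0"
  shows "energy \<Omega> \<alpha> q (\<lambda>_. u1, \<lambda>_. u0, \<lambda>_. um) \<noteq> \<infinity>"
proof -
  have "emeasure (lebesgue_on \<Omega>) (space (lebesgue_on \<Omega>)) \<noteq> \<infinity>"
    using finite_measure.emeasure_finite[OF finite_measure_lebesgue_on[OF assms(1)]] by simp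
  hence "(\<integral>\<^sup>+x. ennreal (H_TF \<alpha> q u1 u0 um) \<partial>lebesgue_on \<Omega>) < \<infinity>"
    by (simp add: ennreal_mult_less_top top.not_eq_extremum)
  thus ?thesis
    unfolding energy_eq_nn_integral[OF assms(2-4)]
    by (metis enn2ereal_eq_top_iff infinity_ennreal_def less_irrefl top_ereal_def)
qed

lemma const_admissible:
  fixes \<Omega> :: "'a::euclidean_space set"
  assumes "\<Omega> \<in> lmeasurable" "0 \<le> u1" "0 \<le> u0" "0 \<le> um"
    and "measure lebesgue \<Omega> * (u1\<^sup>2 + u0\<^sup>2 + um\<^sup>2) = N"
    and "measure lebesgue \<Omega> * (u1\<^sup>2 - um\<^sup>2) = M"
  shows "(\<lambda>_. u1, \<lambda>_. u0, \<lambda>_. um) \<in> admissible \<Omega> N M"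
proof -
  interpret finite_measure "lebesgue_on \<Omega>"
    using assms(1) by (rule finite_measure_lebesgue_on)
  have "measure (lebesgue_on \<Omega>) (space (lebesgue_on \<Omega>)) = measure lebesgue \<Omega>"
    using assms(1) by (simp add: measure_restrict_space fmeasurableD)
  thus ?thesis using assms by (simp add: admissible_def L2_nonneg_def)
qed

text \<open>Zero gap attains the common constant, which bounds every energy from below because the
  gap is nonnegative. Another minimizer has a gap of integral 0, hence a gap that is 0 almost
  everywhere.\<close>

lemma global_minimizer_if_gap_0:
  fixes \<Omega> :: "'a::euclidean_space set"
  assumes \<Omega>: "\<Omega> \<in> lmeasurable" and par: "-1 < \<alpha>" "\<alpha> < 0" "q > 0"
    and A: "A = 1 / \<alpha> * (q / 2 - b\<^sup>2 / (2 * q))"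
    and u: "(\<lambda>_. u1, \<lambda>_. u0, \<lambda>_. um) \<in> admissible \<Omega> N M"
    and gap: "TF_gap \<alpha> q n A b u1 u0 um = 0"
  shows "is_global_minimizer \<Omega> \<alpha> q N M (\<lambda>_. u1, \<lambda>_. u0, \<lambda>_. um)"
    and "is_global_minimizer \<Omega> \<alpha> q N M (v1, v0, vm) \<Longrightarrow>
      AE x in lebesgue_on \<Omega>. TF_gap \<alpha> q n A b (v1 x) (v0 x) (vm x) = 0"
proof -
  define e where "e = ((1 + \<alpha>) * n + \<alpha> * A) * N + b * M
        + measure lebesgue \<Omega> * ((\<alpha> * A\<^sup>2 - (1 + \<alpha>) * n\<^sup>2) / 2)"
  note G = energy_eq_affine_plus_gap[OF \<Omega> par A, where n = n and N = N and M = M, folded e_def]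
  have Eu: "energy \<Omega> \<alpha> q (\<lambda>_. u1, \<lambda>_. u0, \<lambda>_. um) = ereal e"
    using G(2)[OF u energy_const_finite[OF \<Omega> par]] gap by simp
  have G0: "0 \<le> (LINT x|lebesgue_on \<Omega>. TF_gap \<alpha> q n A b (v1 x) (v0 x) (vm x))" for v1 v0 vm
    by (intro integral_nonneg_AE AE_I2 TF_gap_nonneg[OF par])
  show "is_global_minimizer \<Omega> \<alpha> q N M (\<lambda>_. u1, \<lambda>_. u0, \<lambda>_. um)"
    unfolding is_global_minimizer_def
  proof (intro conjI ballI u)
    fix v assume v: "v \<in> admissible \<Omega> N M"
    obtain v1 v0 vm where [simp]: "v = (v1, v0, vm)" by (cases v)
    show "energy \<Omega> \<alpha> q (\<lambda>_. u1, \<lambda>_. u0, \<lambda>_. um) \<le> energy \<Omega> \<alpha> q v"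
      using G(2)[of v1 v0 vm] G0[of v1 v0 vm] v Eu
      by (cases "energy \<Omega> \<alpha> q v = \<infinity>") auto
  qed
  show "AE x in lebesgue_on \<Omega>. TF_gap \<alpha> q n A b (v1 x) (v0 x) (vm x) = 0"
    if "is_global_minimizer \<Omega> \<alpha> q N M (v1, v0, vm)"
  proof -
    have v: "(v1, v0, vm) \<in> admissible \<Omega> N M"
      and le: "energy \<Omega> \<alpha> q (v1, v0, vm) \<le> ereal e"
      using that u Eu unfolding is_global_minimizer_def by auto
    \<comment> \<open>The energy is bounded by the real \<open>e\<close>, so the decomposition
      applies to this minimizer.\<close>
    have fin: "energy \<Omega> \<alpha> q (v1, v0, vm) \<noteq> \<infinity>" using le by auto
    have "(LINT x|lebesgue_on \<Omega>. TF_gap \<alpha> q n A b (v1 x) (v0 x) (vm x)) = 0"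
      using le G(2)[OF v fin] G0[of v1 v0 vm] by simp
    thus ?thesis
      using integral_nonneg_eq_0_iff_AE[OF G(1)[OF v fin]] TF_gap_nonneg[OF par] by auto
  qed
qed

section \<open>The explicit minimizer and its uniqueness\<close>

theorem theorem3p5:
  fixes \<Omega> :: "(real ^ 3) set" and \<alpha> q N M n m :: real
  assumes "smooth_bounded_domain \<Omega>"
    and "N > 0" and "M \<le> N"
    and "n = N / measure lebesgue \<Omega>" and "m = M / measure lebesgue \<Omega>"
    and "-1 < \<alpha>" and "\<alpha> < 0" and "m \<ge> 0" and "q > 0"
  shows "\<exists>b. b_root \<alpha> q n m b \<and> (\<forall>b'. b_root \<alpha> q n m b' \<longrightarrow> b' = b) \<and>
    (0 < m \<and> m < n \<longrightarrow> b \<in> {b_lower \<alpha> q n<..<q}) \<and>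
    (let A = 1 / \<alpha> * (q / 2 - b\<^sup>2 / (2 * q));
         u1 = (q + b) / (2 * q) * sqrt (n + A);
         u0 = sqrt ((q\<^sup>2 - b\<^sup>2) / (2 * q\<^sup>2) * n - (q\<^sup>2 + b\<^sup>2) / (2 * q\<^sup>2) * A);
         um = (q - b) / (2 * q) * sqrt (n + A)
     in 0 \<le> n + A \<and>
        0 \<le> (q\<^sup>2 - b\<^sup>2) / (2 * q\<^sup>2) * n - (q\<^sup>2 + b\<^sup>2) / (2 * q\<^sup>2) * A \<and>
        is_global_minimizer \<Omega> \<alpha> q N M (\<lambda>_. u1, \<lambda>_. u0, \<lambda>_. um) \<and>
        (\<forall>v1 v0 vm. is_global_minimizer \<Omega> \<alpha> q N M (v1, v0, vm) \<longrightarrow>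
           (AE x in lebesgue_on \<Omega>. v1 x = u1 \<and> v0 x = u0 \<and> vm x = um)))"
proof -
  have \<Omega>: "\<Omega> \<in> lmeasurable" and vol: "0 < measure lebesgue \<Omega>"
  proof -
    have "open \<Omega>" "bounded \<Omega>" "\<Omega> \<noteq> {}"
      using assms(1) by (auto simp: smooth_bounded_domain_def)
    thus "\<Omega> \<in> lmeasurable" by (simp add: lmeasurable_open)
    with \<open>open \<Omega>\<close> \<open>\<Omega> \<noteq> {}\<close> show "0 < measure lebesgue \<Omega>"
      using open_not_negligible negligible_iff_measure zero_less_measure_iff by blast
  qed
  note par = \<open>-1 < \<alpha>\<close> \<open>\<alpha> < 0\<close> \<open>q > 0\<close>
  have "m \<le> n" and n0: "0 \<le> n"
    using assms(2-5) vol by (simp_all add: divide_right_mono)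
  then obtain b where b: "b_root \<alpha> q n m b" "\<And>b'. b_root \<alpha> q n m b' \<Longrightarrow> b' = b"
    "0 < m \<Longrightarrow> m < n \<Longrightarrow> b \<in> {b_lower \<alpha> q n<..<q}"
    using b_root_unique_existence[of \<alpha> q m n] par \<open>m \<ge> 0\<close> by metis
  define A where "A = 1 / \<alpha> * (q / 2 - b\<^sup>2 / (2 * q))"
  define X where "X = (q\<^sup>2 - b\<^sup>2) / (2 * q\<^sup>2) * n - (q\<^sup>2 + b\<^sup>2) / (2 * q\<^sup>2) * A"
  define u1 where "u1 = (q + b) / (2 * q) * sqrt (n + A)"
  define u0 where "u0 = sqrt X"
  define um where "um = (q - b) / (2 * q) * sqrt (n + A)"
  have \<alpha>A: "2 * q * (\<alpha> * A) = q\<^sup>2 - b\<^sup>2"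
    using par by (simp add: A_def field_simps power2_eq_square)
  have bl: "b_lower \<alpha> q n \<le> b" and bq: "b \<le> q"
    and cubic: "b^3 - (q\<^sup>2 + 2 * \<alpha> * q * n) * b + 2 * \<alpha> * q\<^sup>2 * m = 0"
    using b(1) by (auto simp: b_root_def)
  have b0: "0 \<le> b" using bl by (smt (verit) b_lower_def real_sqrt_ge_zero)
  \<comment> \<open>The lower bound on \<open>b\<close> is what makes the radicand
    \<open>n + A\<close> nonnegative: \<open>2 * q * (\<alpha> * (n + A))\<close> equals
    \<open>q\<^sup>2 + 2 * \<alpha> * q * n - b\<^sup>2\<close>.\<close>
  have "q\<^sup>2 + 2 * \<alpha> * q * n \<le> b\<^sup>2"
    using real_sqrt_le_iff b0 bl by (auto simp: b_lower_def dest: sqrt_le_D)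
  hence "2 * q * (\<alpha> * (n + A)) \<le> 0"
    using \<alpha>A by (simp add: algebra_simps)
  hence t: "0 \<le> n + A" using par by (simp add: mult_le_0_iff)
  \<comment> \<open>The upper bound on \<open>b\<close> gives \<open>A \<le> 0\<close>, hence a
    nonnegative radicand \<open>X\<close> for \<open>u0\<close>.\<close>
  have bq2: "b\<^sup>2 \<le> q\<^sup>2" using b0 bq by (simp add: power_mono)
  hence "0 \<le> 2 * q * (\<alpha> * A)" using \<alpha>A by simp
  hence A0: "A \<le> 0" using par by (simp add: zero_le_mult_iff)
  have "0 \<le> (q\<^sup>2 - b\<^sup>2) / (2 * q\<^sup>2) * n" using bq2 n0 by simp
  moreover have "(q\<^sup>2 + b\<^sup>2) / (2 * q\<^sup>2) * A \<le> 0" using A0 by (intro mult_nonneg_nonpos) auto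
  ultimately have X: "0 \<le> X" by (simp add: X_def)
  have nonneg: "0 \<le> u1" "0 \<le> u0" "0 \<le> um"
    using X t b0 bq par by (simp_all add: u1_def u0_def um_def)
  have sum: "u1 + um = sqrt (n + A)" and diff: "u1 - um = b / q * sqrt (n + A)"
    using par by (simp_all add: u1_def um_def field_simps)
  have u0: "u0\<^sup>2 = X" using X by (simp add: u0_def)
  have u1: "u1\<^sup>2 = ((q + b) / (2 * q))\<^sup>2 * (n + A)" and um: "um\<^sup>2 = ((q - b) / (2 * q))\<^sup>2 * (n + A)"
    using t unfolding u1_def um_def power_mult_distrib by simp_all
  \<comment> \<open>The squares of \<open>u1\<close> and \<open>um\<close> add up to
    \<open>(q\<^sup>2 + b\<^sup>2) / (2 * q\<^sup>2) * (n + A)\<close>, and \<open>X\<close> is the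
    remainder to \<open>n\<close>.\<close>
  have mass: "u1\<^sup>2 + u0\<^sup>2 + um\<^sup>2 = n"
    unfolding u1 u0 um X_def using par by (simp add: field_simps power2_eq_square)
  have "u1\<^sup>2 - um\<^sup>2 = b / q * (n + A)"
    using t sum diff by (simp add: power2_eq_square square_diff_square_factored)
  \<comment> \<open>Here the cubic enters: it is the magnetization constraint multiplied by the
    nonzero factor \<open>2 * \<alpha> * q\<^sup>2\<close>.\<close>
  moreover have "2 * \<alpha> * q\<^sup>2 * (b / q * (n + A)) = 2 * \<alpha> * q\<^sup>2 * m"
  proof -
    have "2 * \<alpha> * q\<^sup>2 * (b / q * (n + A)) = 2 * \<alpha> * q * n * b + 2 * q * (\<alpha> * A) * b"
      using par by (simp add: field_simps power2_eq_square)
    also have "\<dots> = 2 * \<alpha> * q\<^sup>2 * m"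
      unfolding \<alpha>A using cubic by (simp add: algebra_simps power2_eq_square power3_eq_cube)
    finally show ?thesis .
  qed
  ultimately have magnetization: "u1\<^sup>2 - um\<^sup>2 = m"
    using par by (metis mult_cancel_left mult_eq_0_iff less_irrefl power_not_zero zero_neq_numeral)
  have adm: "(\<lambda>_. u1, \<lambda>_. u0, \<lambda>_. um) \<in> admissible \<Omega> N M"
    using \<Omega> nonneg vol assms(4,5) by (intro const_admissible) (simp_all add: mass magnetization)
  have gap: "TF_gap \<alpha> q n A b u1 u0 um = 0"
    unfolding TF_gap_eq_0_iff[OF par] using mass sum diff t by simp
  note minimizer = global_minimizer_if_gap_0[OF \<Omega> par A_def adm gap]
  have "AE x in lebesgue_on \<Omega>. v1 x = u1 \<and> v0 x = u0 \<and> vm x = um"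
    if v: "is_global_minimizer \<Omega> \<alpha> q N M (v1, v0, vm)" for v1 v0 vm
  proof -
    have "AE x in lebesgue_on \<Omega>. 0 \<le> v1 x" "AE x in lebesgue_on \<Omega>. 0 \<le> v0 x"
      "AE x in lebesgue_on \<Omega>. 0 \<le> vm x"
      using v by (auto simp: is_global_minimizer_def admissible_def L2_nonneg_def)
    with minimizer(2)[OF v] show ?thesis
    proof eventually_elim
      case (elim x)
      hence x: "(v1 x)\<^sup>2 + (v0 x)\<^sup>2 + (vm x)\<^sup>2 = n" "(v1 x + vm x)\<^sup>2 = n + A"
        "v1 x - vm x = b / q * (v1 x + vm x)"
        unfolding TF_gap_eq_0_iff[OF par] by auto
      \<comment> \<open>Nonnegativity selects the positive root of \<open>s\<^sup>2 = n + A\<close>.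
        Then \<open>d\<close> follows linearly, and \<open>v0 x\<close> from the mass, again by its
        sign.\<close>
      have "v1 x + vm x = u1 + um"
        using x(2) elim unfolding sum by (metis add_nonneg_nonneg real_sqrt_unique)
      moreover from this have "v1 x - vm x = u1 - um"
        using x(3) sum diff by simp
      ultimately have eq: "v1 x = u1" "vm x = um" by auto
      hence "(v0 x)\<^sup>2 = u0\<^sup>2" using x(1) mass by simp
      thus ?case using eq elim nonneg by (simp add: power2_eq_iff_nonneg)
    qed
  qed
  with b t X minimizer(1) show ?thesis
    unfolding Let_def u1_def u0_def um_def X_def A_def by (intro exI[of _ b]) blast
qed

end
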